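(* Let $\mu>0$, $M>0$, and let $g:Q\to\mathbb{R}^n$ be a relatively $\mu$-strongly monotone and relatively $M$-bounded operator (with respect to the Bregman divergence $V$). Let $x_0\in Q$ and let the points $x_1,x_2,\dots\in Q$ be produced by the algorithm $$x_{k+1} := \arg\min_{x\in Q}\{h_k\langle g(x_k),x\rangle + V(x,x_k)\},\qquad h_k=\frac{2}{\mu(k+1)},\qquad k=0,1,2,\dots$$ Then after $N$ iterations ($N\ge 1$) the inequality $$\max_{x\in Q}\langle g(x),\widehat{x}-x\rangle \le \frac{2M^2}{\mu(N+1)}$$ holds, where $$\widehat{x}=\sum_{k=1}^{N}\frac{2k}{N(N+1)}\,x_k .$$
   Context: $Q\subseteq\mathbb{R}^n$ is a closed convex set and $g:Q\to\mathbb{R}^n$. Standing assumption: there exists a (weak) solution $x_*\in Q$ of the variational inequality, i.e. $\max_{x\in Q}\langle g(x),x_*-x\rangle\le 0$. A bound $\max_{x\in Q}\varphi(x)\le c$ means $\varphi(x)\le c$ for all $x\in Q$. $d$ is a convex differentiable prox-function (not necessarily strongly convex), and the corresponding Bregman divergence is $V(y,x)=d(y)-d(x)-\langle\nabla d(x),y-x\rangle$ for $x,y\in Q$. The operator $g$ is relatively $\mu$-strongly monotone ($\mu>0$) if $\mu V(y,x)+\mu V(x,y)\le\langle g(y)-g(x),y-x\rangle$ for all $x,y\in Q$. The operator $g$ is relatively $M$-bounded ($M>0$) if $\langle g(x),x-y\rangle\le M\sqrt{2V(y,x)}$ for all $x,y\in Q$. The minimizers defining the iterates of the algorithm are understood to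 exist. *)

theory Defs
  imports "HOL-Analysis.Analysis"
begin

(* Differentiability is taken relative to Q, which may have empty interior. The gradient is
   then not unique, but G x \<bullet> (y - x) for x, y in Q is: it is the one-sided derivative of d
   at x in the direction y - x. So bregman d G does not depend on the choice of G on Q. *)
definition has_gradient_on ::
    "(real ^ 'n \<Rightarrow> real) \<Rightarrow> (real ^ 'n \<Rightarrow> real ^ 'n) \<Rightarrow> (real ^ 'n) set \<Rightarrow> bool" where
  "has_gradient_on d G Q \<longleftrightarrow> (\<forall>x\<in>Q. (d has_derivative (\<lambda>v. G x \<bullet> v)) (at x within Q))"

definition prox_function ::
    "(real ^ 'n) set \<Rightarrow> (real ^ 'n \<Rightarrow> real) \<Rightarrow> (real ^ 'n \<Rightarrow> real ^ 'n) \<Rightarrow> bool" where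
  "prox_function Q d G \<longleftrightarrow> convex_on Q d \<and> has_gradient_on d G Q"

definition bregman ::
    "(real ^ 'n \<Rightarrow> real) \<Rightarrow> (real ^ 'n \<Rightarrow> real ^ 'n) \<Rightarrow> real ^ 'n \<Rightarrow> real ^ 'n \<Rightarrow> real" where
  "bregman d G y x = d y - d x - G x \<bullet> (y - x)"

definition weak_vi_solution ::
    "(real ^ 'n) set \<Rightarrow> (real ^ 'n \<Rightarrow> real ^ 'n) \<Rightarrow> real ^ 'n \<Rightarrow> bool" where
  "weak_vi_solution Q g xs \<longleftrightarrow> xs \<in> Q \<and> (\<forall>x\<in>Q. g x \<bullet> (xs - x) \<le> 0)"

definition relatively_strongly_monotone ::
    "(real ^ 'n) set \<Rightarrow> (real ^ 'n \<Rightarrow> real ^ 'n \<Rightarrow> real) \<Rightarrow> real \<Rightarrow> (real ^ 'n \<Rightarrow> real ^ 'n) \<Rightarrow> bool" where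
  "relatively_strongly_monotone Q V \<mu> g \<longleftrightarrow>
     (\<forall>x\<in>Q. \<forall>y\<in>Q. \<mu> * V y x + \<mu> * V x y \<le> (g y - g x) \<bullet> (y - x))"

definition relatively_bounded ::
    "(real ^ 'n) set \<Rightarrow> (real ^ 'n \<Rightarrow> real ^ 'n \<Rightarrow> real) \<Rightarrow> real \<Rightarrow> (real ^ 'n \<Rightarrow> real ^ 'n) \<Rightarrow> bool" where
  "relatively_bounded Q V M g \<longleftrightarrow>
     (\<forall>x\<in>Q. \<forall>y\<in>Q. g x \<bullet> (x - y) \<le> M * sqrt (2 * V y x))"

(* Since d need not be strictly convex, minimizers need not be unique:
   x (k + 1) may be any of them. *)
definition mirror_descent ::
    "(real ^ 'n) set \<Rightarrow> (real ^ 'n \<Rightarrow> real ^ 'n \<Rightarrow> real) \<Rightarrow> (real ^ 'n \<Rightarrow> real ^ 'n) \<Rightarrow> (nat \<Rightarrow> real)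
      \<Rightarrow> (nat \<Rightarrow> real ^ 'n) \<Rightarrow> bool" where
  "mirror_descent Q V g h x \<longleftrightarrow>
     x 0 \<in> Q \<and>
     (\<forall>k. is_arg_min (\<lambda>z. h k * (g (x k) \<bullet> z) + V z (x k)) (\<lambda>z. z \<in> Q) (x (k + 1)))"

end

theory Submission imports Defs begin

text \<open>
  Fix \<open>y \<in> Q\<close> and write \<open>D\<^sub>k = V(y, x\<^sub>k)\<close>. First-order optimality of \<open>x\<^sub>k\<^sub>+\<^sub>1\<close> and the three-point identity
  for Bregman divergences give the mirror-descent step inequality
  \<open>h\<^sub>k \<langle>g(x\<^sub>k), x\<^sub>k - y\<rangle> \<le> D\<^sub>k - D\<^sub>k\<^sub>+\<^sub>1 + (h\<^sub>k \<langle>g(x\<^sub>k), x\<^sub>k - x\<^sub>k\<^sub>+\<^sub>1\<rangle> - V(x\<^sub>k\<^sub>+\<^sub>1, x\<^sub>k))\<close>.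
  Relative boundedness of \<open>g\<close> replaces strong convexity of \<open>d\<close>: with \<open>s = sqrt (2 V(x\<^sub>k\<^sub>+\<^sub>1, x\<^sub>k))\<close> the
  bracket is at most \<open>h\<^sub>k M s - s\<^sup>2 / 2 \<le> h\<^sub>k\<^sup>2 M\<^sup>2 / 2\<close>
  (lemma \<open>mirror_step_relatively_bounded\<close>).

  Strong monotonicity trades \<open>g(x\<^sub>k)\<close> for \<open>g(y)\<close> and gains \<open>- \<mu> D\<^sub>k\<close>. For \<open>h\<^sub>k = 2 / (\<mu> (k + 1))\<close> this
  gain turns the coefficient \<open>1 / h\<^sub>k = \<mu> (k + 1) / 2\<close> of \<open>D\<^sub>k\<close> into \<open>\<mu> (k - 1) / 2\<close>, so
  \<open>\<langle>g(y), x\<^sub>k - y\<rangle> \<le> \<mu> / 2 ((k - 1) D\<^sub>k - (k + 1) D\<^sub>k\<^sub>+\<^sub>1) + M\<^sup>2 / (\<mu> (k + 1))\<close>.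
  After multiplication by the weight \<open>k\<close> the divergence terms telescope, since the coefficient
  \<open>k (k + 1)\<close> of \<open>D\<^sub>k\<^sub>+\<^sub>1\<close> recurs in the next step, and the first one, \<open>0 \<cdot> 1 \<cdot> D\<^sub>1\<close>, vanishes; this is
  why the bound does not depend on the starting point. The errors sum to at most \<open>N M\<^sup>2 / \<mu>\<close>
  (lemma \<open>weighted_regret_bound\<close>). Dividing by the total weight \<open>N (N + 1) / 2\<close> gives the rate.
\<close>

text \<open>
  The difference quotients along the segment are bounded by \<open>c\<close>, hence so is their limit. Both uses
  of differentiability below, the gradient inequality and the optimality condition, are instances;
  only one-sided derivatives enter, so \<open>Q\<close> may have empty interior.
\<close>

lemma derivative_within_le_of_segment_bound:
  fixes f :: "'a::real_normed_vector \<Rightarrow> real"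
  assumes "convex Q" "a \<in> Q" "y \<in> Q"
    and der: "(f has_derivative f') (at a within Q)"
    and bound: "\<And>t. 0 < t \<Longrightarrow> t \<le> 1 \<Longrightarrow> f (a + t *\<^sub>R (y - a)) \<le> f a + t * c"
  shows "f' (y - a) \<le> c"
proof -
  let ?p = "\<lambda>t::real. a + t *\<^sub>R (y - a)"
  have "?p ` {0..1} \<subseteq> Q"
  proof
    fix z assume "z \<in> ?p ` {0..1}"
    then obtain t where "0 \<le> t" "t \<le> 1" "z = (1 - t) *\<^sub>R a + t *\<^sub>R y"
      by (auto simp: algebra_simps)
    then show "z \<in> Q" using assms(1-3) by (simp add: convexD)
  qed
  then have "(f has_derivative f') (at (?p 0) within ?p ` {0..1})"
    using der by (auto intro: has_derivative_subset)
  moreover have "(?p has_derivative (\<lambda>t. t *\<^sub>R (y - a))) (at 0 within {0..1})"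
    by (auto intro!: derivative_eq_intros)
  ultimately have "((\<lambda>t. f (?p t)) has_derivative (\<lambda>t. f' (t *\<^sub>R (y - a)))) (at 0 within {0..1})"
    using diff_chain_within[of ?p _ 0 "{0..1}" f f'] by (simp add: o_def)
  moreover have "(\<lambda>t. f' (t *\<^sub>R (y - a))) = (\<lambda>t. f' (y - a) * t)"
    using has_derivative_bounded_linear[OF der] by (auto simp: linear_simps mult.commute)
  ultimately have "((\<lambda>t. f (?p t)) has_real_derivative f' (y - a)) (at 0 within {0..1})"
    by (simp add: has_field_derivative_def)
  then have "((\<lambda>t. (f (?p t) - f a) / t) \<longlongrightarrow> f' (y - a)) (at 0 within {0..1})"
    by (simp add: has_field_derivative_iff)
  moreover have "\<forall>\<^sub>F t in at 0 within {0..1}. (f (?p t) - f a) / t \<le> c"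
    unfolding eventually_at_filter
  proof (intro always_eventually allI impI)
    fix t :: real assume "t \<noteq> 0" "t \<in> {0..1}"
    then show "(f (?p t) - f a) / t \<le> c"
      using bound[of t] by (simp add: pos_divide_le_eq algebra_simps)
  qed
  moreover have "at (0::real) within {0..1} \<noteq> bot"
    by (simp add: at_within_Icc_at_right)
  ultimately show ?thesis
    by (intro tendsto_upperbound)
qed

lemma bregman_nonneg:
  assumes "convex Q" "prox_function Q d G" "a \<in> Q" "y \<in> Q"
  shows "bregman d G y a \<ge> 0"
proof -
  have conv: "convex_on Q d" and der: "(d has_derivative (\<lambda>v. G a \<bullet> v)) (at a within Q)"
    using assms unfolding prox_function_def has_gradient_on_def by auto
  have "G a \<bullet> (y - a) \<le> d y - d a"
  proof (rule derivative_within_le_of_segment_bound[OF assms(1,3,4) der])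
    fix t :: real assume "0 < t" "t \<le> 1"
    then have "d ((1 - t) *\<^sub>R a + t *\<^sub>R y) \<le> (1 - t) * d a + t * d y"
      using convex_onD[OF conv, of t a y] assms by simp
    then show "d (a + t *\<^sub>R (y - a)) \<le> d a + t * (d y - d a)"
      by (simp add: algebra_simps)
  qed
  then show ?thesis by (simp add: bregman_def)
qed

text \<open>
  First-order optimality of \<open>z\<close> reads \<open>\<langle>p + G z - G a, y - z\<rangle> \<ge> 0\<close>, and \<open>\<langle>G z - G a, y - z\<rangle>\<close> is the
  difference of divergences on the right by the three-point identity.
\<close>

lemma bregman_prox_step:
  fixes p :: "real ^ 'n"
  assumes "convex Q" "prox_function Q d G" "y \<in> Q"
    and min: "is_arg_min (\<lambda>z. p \<bullet> z + bregman d G z a) (\<lambda>z. z \<in> Q) z"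
  shows "p \<bullet> (z - y) \<le> bregman d G y a - bregman d G y z - bregman d G z a"
proof -
  let ?F = "\<lambda>z. p \<bullet> z + bregman d G z a"
  have zQ: "z \<in> Q" and le: "\<And>w. w \<in> Q \<Longrightarrow> ?F z \<le> ?F w"
    using min unfolding is_arg_min_def by (auto simp: not_less)
  have "(d has_derivative (\<lambda>v. G z \<bullet> v)) (at z within Q)"
    using assms zQ unfolding prox_function_def has_gradient_on_def by auto
  then have der: "((\<lambda>w. - ?F w) has_derivative (\<lambda>v. - ((p + G z - G a) \<bullet> v))) (at z within Q)"
    unfolding bregman_def
    by (auto intro!: derivative_eq_intros simp: algebra_simps)
  have "- ((p + G z - G a) \<bullet> (y - z)) \<le> 0"
  proof (rule derivative_within_le_of_segment_bound[OF assms(1) zQ assms(3) der])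
    fix t :: real assume t: "0 < t" "t \<le> 1"
    have "(1 - t) *\<^sub>R z + t *\<^sub>R y \<in> Q"
      using assms zQ t by (simp add: convexD)
    then have "z + t *\<^sub>R (y - z) \<in> Q" by (simp add: algebra_simps)
    from le[OF this] show "- ?F (z + t *\<^sub>R (y - z)) \<le> - ?F z + t * 0" by simp
  qed
  then show ?thesis by (simp add: bregman_def algebra_simps)
qed

lemma mirror_step_relatively_bounded:
  fixes g :: "real ^ 'n \<Rightarrow> real ^ 'n"
  assumes "convex Q" "prox_function Q d G" "relatively_bounded Q (bregman d G) M g"
    and "h \<ge> 0" "a \<in> Q" "y \<in> Q"
    and min: "is_arg_min (\<lambda>z. h * (g a \<bullet> z) + bregman d G z a) (\<lambda>z. z \<in> Q) z"
  shows "h * (g a \<bullet> (a - y)) \<le> bregman d G y a - bregman d G y z + h\<^sup>2 * M\<^sup>2 / 2"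
proof -
  have zQ: "z \<in> Q" using min by (simp add: is_arg_min_def)
  define s where "s = sqrt (2 * bregman d G z a)"
  have s2: "bregman d G z a = s\<^sup>2 / 2"
    using bregman_nonneg[OF assms(1,2) \<open>a \<in> Q\<close> zQ] by (simp add: s_def)
  have "g a \<bullet> (a - z) \<le> M * s"
    using assms(3) \<open>a \<in> Q\<close> zQ unfolding relatively_bounded_def s_def by blast
  then have "h * (g a \<bullet> (a - z)) \<le> h * (M * s)"
    using \<open>h \<ge> 0\<close> by (rule mult_left_mono)
  also have "\<dots> \<le> s\<^sup>2 / 2 + h\<^sup>2 * M\<^sup>2 / 2"
    using zero_le_power2[of "h * M - s"] by (simp add: power2_eq_square algebra_simps)
  finally have "h * (g a \<bullet> (a - z)) \<le> bregman d G z a + h\<^sup>2 * M\<^sup>2 / 2"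
    by (simp add: s2)
  moreover have "h * (g a \<bullet> (z - y)) \<le> bregman d G y a - bregman d G y z - bregman d G z a"
    using bregman_prox_step[OF assms(1,2) \<open>y \<in> Q\<close>, of "h *\<^sub>R g a" a z] min by simp
  ultimately show ?thesis by (simp add: algebra_simps)
qed

lemma mirror_descent_mem:
  assumes "mirror_descent Q V g h x"
  shows "x k \<in> Q"
  using assms unfolding mirror_descent_def is_arg_min_def by (cases k) auto

text \<open>
  Carrying the divergence term on the left-hand side makes the telescoping an induction on \<open>N\<close>.
\<close>

lemma weighted_regret_bound:
  fixes g :: "real ^ 'n \<Rightarrow> real ^ 'n"
  assumes "convex Q" "prox_function Q d G" "\<mu> > 0"
    and mono: "relatively_strongly_monotone Q (bregman d G) \<mu> g"
    and bdd: "relatively_bounded Q (bregman d G) M g"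
    and md: "mirror_descent Q (bregman d G) g (\<lambda>k. 2 / (\<mu> * (real k + 1))) x"
    and "y \<in> Q"
  shows "(\<Sum>k=1..N. real k * (g y \<bullet> (x k - y)))
           + \<mu> / 2 * (real N * (real N + 1)) * bregman d G y (x (N + 1)) \<le> real N * M\<^sup>2 / \<mu>"
proof (induction N)
  case 0
  then show ?case by simp
next
  case (Suc N)
  define k where "k = real (Suc N)"
  define D where "D = bregman d G y (x (Suc N))"
  define D' where "D' = bregman d G y (x (Suc (Suc N)))"
  have k: "k > 0" by (simp add: k_def)
  have xQ: "x (Suc N) \<in> Q" by (rule mirror_descent_mem[OF md])
  have "2 / (\<mu> * (k + 1)) * (g (x (Suc N)) \<bullet> (x (Suc N) - y))
          \<le> D - D' + (2 / (\<mu> * (k + 1)))\<^sup>2 * M\<^sup>2 / 2"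
    unfolding D_def D'_def k_def
  proof (rule mirror_step_relatively_bounded[OF assms(1,2) bdd _ xQ \<open>y \<in> Q\<close>])
    have "is_arg_min (\<lambda>z. 2 / (\<mu> * (real (Suc N) + 1)) * (g (x (Suc N)) \<bullet> z)
        + bregman d G z (x (Suc N))) (\<lambda>z. z \<in> Q) (x (Suc N + 1))"
      using md unfolding mirror_descent_def by blast
    then show "is_arg_min (\<lambda>z. 2 / (\<mu> * (real (Suc N) + 1)) * (g (x (Suc N)) \<bullet> z)
        + bregman d G z (x (Suc N))) (\<lambda>z. z \<in> Q) (x (Suc (Suc N)))"
      by (metis Suc_eq_plus1)
  qed (use \<open>\<mu> > 0\<close> in simp)
  then have "\<mu> * (k + 1) / 2 * (2 / (\<mu> * (k + 1)) * (g (x (Suc N)) \<bullet> (x (Suc N) - y)))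
          \<le> \<mu> * (k + 1) / 2 * (D - D' + (2 / (\<mu> * (k + 1)))\<^sup>2 * M\<^sup>2 / 2)"
    using \<open>\<mu> > 0\<close> k by (intro mult_left_mono) auto
  also have "\<mu> * (k + 1) / 2 * (2 / (\<mu> * (k + 1)) * (g (x (Suc N)) \<bullet> (x (Suc N) - y)))
          = g (x (Suc N)) \<bullet> (x (Suc N) - y)"
    using \<open>\<mu> > 0\<close> k by simp
  also have "\<mu> * (k + 1) / 2 * (D - D' + (2 / (\<mu> * (k + 1)))\<^sup>2 * M\<^sup>2 / 2)
          = \<mu> * (k + 1) / 2 * (D - D') + M\<^sup>2 / (\<mu> * (k + 1))"
  proof -
    have "c / 2 * (E + (2 / c)\<^sup>2 * m / 2) = c / 2 * E + m / c" if "c \<noteq> 0" for c E m :: real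
      using that by (simp add: field_simps power2_eq_square)
    then show ?thesis using \<open>\<mu> > 0\<close> k by simp
  qed
  finally have step: "g (x (Suc N)) \<bullet> (x (Suc N) - y)
          \<le> \<mu> * (k + 1) / 2 * (D - D') + M\<^sup>2 / (\<mu> * (k + 1))" .
  have "\<mu> * D + \<mu> * bregman d G (x (Suc N)) y \<le> (g y - g (x (Suc N))) \<bullet> (y - x (Suc N))"
    using mono xQ \<open>y \<in> Q\<close> unfolding relatively_strongly_monotone_def D_def by blast
  moreover have "0 \<le> \<mu> * bregman d G (x (Suc N)) y"
    using bregman_nonneg[OF assms(1,2) \<open>y \<in> Q\<close> xQ] \<open>\<mu> > 0\<close> by simp
  ultimately have "g y \<bullet> (x (Suc N) - y) \<le> g (x (Suc N)) \<bullet> (x (Suc N) - y) - \<mu> * D"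
    by (simp add: algebra_simps)
  moreover have "\<mu> * (k + 1) / 2 * (D - D') - \<mu> * D = \<mu> / 2 * ((k - 1) * D - (k + 1) * D')"
    by (simp add: field_simps)
  ultimately have "g y \<bullet> (x (Suc N) - y)
          \<le> \<mu> / 2 * ((k - 1) * D - (k + 1) * D') + M\<^sup>2 / (\<mu> * (k + 1))"
    using step by linarith
  then have "k * (g y \<bullet> (x (Suc N) - y))
          \<le> k * (\<mu> / 2 * ((k - 1) * D - (k + 1) * D') + M\<^sup>2 / (\<mu> * (k + 1)))"
    using k by (intro mult_left_mono) auto
  also have "\<dots> = \<mu> / 2 * ((k - 1) * k) * D - \<mu> / 2 * (k * (k + 1)) * D'
      + k * (M\<^sup>2 / (\<mu> * (k + 1)))"
    by (simp add: algebra_simps add_divide_distrib diff_divide_distrib)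
  also have "k * (M\<^sup>2 / (\<mu> * (k + 1))) \<le> M\<^sup>2 / \<mu>"
  proof -
    have "k * (M\<^sup>2 / (\<mu> * (k + 1))) = k / (k + 1) * (M\<^sup>2 / \<mu>)" by simp
    also have "\<dots> \<le> 1 * (M\<^sup>2 / \<mu>)"
      using k \<open>\<mu> > 0\<close> by (intro mult_right_mono) auto
    finally show ?thesis by simp
  qed
  finally have "k * (g y \<bullet> (x (Suc N) - y)) + \<mu> / 2 * (k * (k + 1)) * D'
      \<le> \<mu> / 2 * ((k - 1) * k) * D + M\<^sup>2 / \<mu>"
    by simp
  moreover have "(\<Sum>k=1..N. real k * (g y \<bullet> (x k - y))) + \<mu> / 2 * ((k - 1) * k) * D
      \<le> (k - 1) * M\<^sup>2 / \<mu>"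
    using Suc.IH by (simp add: k_def D_def add.commute)
  moreover have "(k - 1) * M\<^sup>2 / \<mu> + M\<^sup>2 / \<mu> = k * M\<^sup>2 / \<mu>"
    using \<open>\<mu> > 0\<close> by (simp add: field_simps)
  ultimately have "(\<Sum>k=1..N. real k * (g y \<bullet> (x k - y))) + k * (g y \<bullet> (x (Suc N) - y))
      + \<mu> / 2 * (k * (k + 1)) * D' \<le> k * M\<^sup>2 / \<mu>"
    by linarith
  then show ?case by (simp add: k_def D'_def)
qed

theorem theorem1:
  fixes Q :: "(real ^ 'n) set"
    and g G :: "real ^ 'n \<Rightarrow> real ^ 'n"
    and d :: "real ^ 'n \<Rightarrow> real"
    and \<mu> M :: real
    and x :: "nat \<Rightarrow> real ^ 'n"
    and N :: nat
  assumes "closed Q" and "convex Q"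
    and "\<exists>xs. weak_vi_solution Q g xs"
    and "prox_function Q d G"
    and "\<mu> > 0" and "M > 0"
    and "relatively_strongly_monotone Q (bregman d G) \<mu> g"
    and "relatively_bounded Q (bregman d G) M g"
    and "mirror_descent Q (bregman d G) g (\<lambda>k. 2 / (\<mu> * (real k + 1))) x"
    and "N \<ge> 1"
  shows "\<forall>y\<in>Q. g y \<bullet> ((\<Sum>k=1..N. (2 * real k / (real N * (real N + 1))) *\<^sub>R x k) - y)
           \<le> 2 * M\<^sup>2 / (\<mu> * (real N + 1))"
proof
  fix y assume y: "y \<in> Q"
  define w where "w = 2 / (real N * (real N + 1))"
  have N: "real N > 0" using \<open>N \<ge> 1\<close> by simp
  have "(\<Sum>k=1..N. real k) = real N * (real N + 1) / 2"
    by (induction N) (auto simp: field_simps)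
  then have w_total: "w * (\<Sum>k=1..N. real k) = 1"
    using N by (simp add: w_def)
  have "g y \<bullet> ((\<Sum>k=1..N. (2 * real k / (real N * (real N + 1))) *\<^sub>R x k) - y)
      = w * (\<Sum>k=1..N. real k * (g y \<bullet> x k)) - (w * (\<Sum>k=1..N. real k)) * (g y \<bullet> y)"
    unfolding w_total by (simp add: w_def inner_diff_right inner_sum_right sum_distrib_left mult.assoc)
  also have "\<dots> = w * (\<Sum>k=1..N. real k * (g y \<bullet> (x k - y)))"
    by (simp add: inner_diff_right right_diff_distrib sum_subtractf sum_distrib_right)
  also have "\<dots> \<le> w * (real N * M\<^sup>2 / \<mu>)"
  proof (rule mult_left_mono)
    have "0 \<le> bregman d G y (x (N + 1))"
      using bregman_nonneg[OF assms(2,4)] mirror_descent_mem[OF assms(9)] y by blast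
    then have "0 \<le> \<mu> / 2 * (real N * (real N + 1)) * bregman d G y (x (N + 1))"
      using \<open>\<mu> > 0\<close> by simp
    then show "(\<Sum>k=1..N. real k * (g y \<bullet> (x k - y))) \<le> real N * M\<^sup>2 / \<mu>"
      using weighted_regret_bound[OF assms(2,4,5,7,8,9) y, of N] by linarith
  qed (simp add: w_def)
  also have "\<dots> = 2 * M\<^sup>2 / (\<mu> * (real N + 1))"
    using N \<open>\<mu> > 0\<close> by (simp add: w_def divide_simps)
  finally show "g y \<bullet> ((\<Sum>k=1..N. (2 * real k / (real N * (real N + 1))) *\<^sub>R x k) - y)
      \<le> 2 * M\<^sup>2 / (\<mu> * (real N + 1))" .
qed

end
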